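(* Let $\mathfrak B,\mathfrak B'$ be flags of bases of the uniform flag matroid $\mathfrak U_n=(U_{0,n},U_{1,n},\dots,U_{n,n})$, let $\pi_{\mathfrak B},\pi_{\mathfrak B'}$ be their Gale permutations and $\tau_{\mathfrak B},\tau_{\mathfrak B'}$ their Bruhat permutations. The following are equivalent: (i) $\mathfrak B\leq_G\mathfrak B'$; (ii) $\pi_{\mathfrak B}\leq_G\pi_{\mathfrak B'}$; (iii) $\tau_{\mathfrak B}\geq_B\tau_{\mathfrak B'}$.
   Context: $[n]=\{1,\dots,n\}$; $U_{k,n}$ is the uniform matroid of rank $k$ on $[n]$. A flag of bases of $\mathfrak U_n$ is a chain $\mathfrak B=(B_0\subseteq B_1\subseteq\dots\subseteq B_n)$ with $B_i\in\binom{[n]}{i}$. For $A=\{a_1<\dots<a_k\}$, $B=\{b_1<\dots<b_k\}$ in $\binom{[n]}{k}$, $A\leq_G B$ (Gale order) iff $a_i\leq b_i$ for all $i$. For flags, $\mathfrak B\leq_G\mathfrak B'$ iff $B_i\leq_G B'_i$ for all $i\in[n]$. The Gale permutation $\pi=\pi_{\mathfrak B}\in S_n$ of $\mathfrak B$ is defined by $\{\pi(i)\}=B_i\setminus B_{i-1}$ for $i=1,\dots,n$. The Bruhat permutation $\tau=\tau_{\mathfrak B}\in S_n$ is $\tau=\overline\pi^{-1}$, where $\overline\pi(i)=\pi(n-i+1)$. One defines $\pi_{\mathfrak B}\leq_G\pi_{\mathfrak B'}$ iff $\mathfrak B\leq_G\mathfrak B'$. Strong Bruhat order $\leq_B$ on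 $S_n$: $v$ covers $u$, written $u\prec_B v$, if $v=u(i,j)$ (i.e. $v=u\circ(i,j)$, exchanging the values in positions $i,j$) for some $i<j$ with $u(i)<u(j)$ such that for all $i<k<j$ one has $u(k)<u(i)$ or $u(k)>u(j)$; $\leq_B$ is the reflexive and transitive closure of this relation. *)

theory Defs
  imports Main "HOL-Combinatorics.Permutations"
begin

text \<open>The ground set \<open>[n]\<close> is \<open>{1..n}\<close>, and elements of \<open>S\<^sub>n\<close> are functions \<open>p\<close> on \<open>nat\<close> with
  \<open>p permutes {1..n}\<close>, i.e. extended by the identity outside \<open>[n]\<close>.\<close>

definition uniform_bases :: "nat \<Rightarrow> nat \<Rightarrow> nat set set" where
  "uniform_bases k n = {A. A \<subseteq> {1..n} \<and> card A = k}"

text \<open>A flag \<open>B\<^sub>0 \<subseteq> \<dots> \<subseteq> B\<^sub>n\<close> is a function on \<open>nat\<close> of which only the values at \<open>0, \<dots>, n\<close> matter.\<close>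

definition flag_of_bases :: "nat \<Rightarrow> (nat \<Rightarrow> nat set) \<Rightarrow> bool" where
  "flag_of_bases n B \<longleftrightarrow>
     (\<forall>i\<le>n. B i \<in> uniform_bases i n) \<and> (\<forall>i<n. B i \<subseteq> B (Suc i))"

text \<open>Since \<open>list_all2\<close> forces equal lengths, only finite sets of the same cardinality are
  compared in the intended use below.\<close>

definition gale_le :: "nat set \<Rightarrow> nat set \<Rightarrow> bool" where
  "gale_le A B \<longleftrightarrow> list_all2 (\<le>) (sorted_list_of_set A) (sorted_list_of_set B)"

definition flag_gale_le :: "nat \<Rightarrow> (nat \<Rightarrow> nat set) \<Rightarrow> (nat \<Rightarrow> nat set) \<Rightarrow> bool" where
  "flag_gale_le n B B' \<longleftrightarrow> (\<forall>i\<in>{1..n}. gale_le (B i) (B' i))"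

definition gale_perm :: "nat \<Rightarrow> (nat \<Rightarrow> nat set) \<Rightarrow> nat \<Rightarrow> nat" where
  "gale_perm n B i = (if i \<in> {1..n} then the_elem (B i - B (i - 1)) else i)"

definition reverse_perm :: "nat \<Rightarrow> (nat \<Rightarrow> nat) \<Rightarrow> nat \<Rightarrow> nat" where
  "reverse_perm n p i = (if i \<in> {1..n} then p (n - i + 1) else i)"

definition bruhat_perm :: "nat \<Rightarrow> (nat \<Rightarrow> nat set) \<Rightarrow> nat \<Rightarrow> nat" where
  "bruhat_perm n B = inv (reverse_perm n (gale_perm n B))"

text \<open>The Gale order on permutations is transported from flags along \<open>gale_perm\<close>.\<close>

definition perm_gale_le :: "nat \<Rightarrow> (nat \<Rightarrow> nat) \<Rightarrow> (nat \<Rightarrow> nat) \<Rightarrow> bool" where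
  "perm_gale_le n p q \<longleftrightarrow>
     (\<exists>B B'. flag_of_bases n B \<and> flag_of_bases n B' \<and>
        p = gale_perm n B \<and> q = gale_perm n B' \<and> flag_gale_le n B B')"

definition bruhat_covered :: "nat \<Rightarrow> (nat \<Rightarrow> nat) \<Rightarrow> (nat \<Rightarrow> nat) \<Rightarrow> bool" where
  "bruhat_covered n u v \<longleftrightarrow> u permutes {1..n} \<and>
     (\<exists>i j. i \<in> {1..n} \<and> j \<in> {1..n} \<and> i < j \<and> u i < u j \<and>
        (\<forall>k. i < k \<and> k < j \<longrightarrow> u k < u i \<or> u k > u j) \<and>
        v = u \<circ> transpose i j)"

definition bruhat_le :: "nat \<Rightarrow> (nat \<Rightarrow> nat) \<Rightarrow> (nat \<Rightarrow> nat) \<Rightarrow> bool" where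
  "bruhat_le n u v \<longleftrightarrow>
     u permutes {1..n} \<and> v permutes {1..n} \<and> (bruhat_covered n)\<^sup>*\<^sup>* u v"

end

theory Submission
  imports Defs
begin

text \<open>All orders in the theorem are comparisons of counting functions.  A set \<open>A\<close> is Gale-below a
  set \<open>B\<close> of the same size iff every initial segment \<open>{..m}\<close> contains at least as many elements
  of \<open>A\<close> as of \<open>B\<close> (\<open>gale_le_iff_card_le\<close>).  The members of a flag are the upper level sets of
  its Bruhat permutation, \<open>B\<^sub>i = {x. \<tau> x \<ge> n + 1 - i}\<close> (\<open>flag_member_iff_bruhat_perm_ge\<close>), so the
  Gale order on flags says that \<open>#{x \<le> m. \<tau> x \<ge> j}\<close> dominates \<open>#{x \<le> m. \<tau>' x \<ge> j}\<close> for all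
  \<open>m\<close> and \<open>j\<close>.

  It remains to see that this domination is the strong Bruhat order \<open>\<tau>' \<le>\<^sub>B \<tau>\<close>, which is the
  classical tableau criterion (\<open>bruhat_le_iff_corner_count_le\<close>).  Passing to a cover raises the
  counts on a rectangle of pairs \<open>(m, j)\<close> by one and leaves the others unchanged
  (\<open>corner_count_transpose\<close>), hence the Bruhat order implies domination.  Conversely, if \<open>u\<close> is
  strictly dominated by \<open>v\<close>, then some cover of \<open>u\<close> is still dominated by \<open>v\<close>
  (\<open>dominated_cover_exists\<close>); as each cover increases the total of the counts, finitely many
  covers lead from \<open>u\<close> to \<open>v\<close>.

  The order on Gale permutations adds nothing, because a flag is recovered from its Gale
  permutation as \<open>B\<^sub>i = \<pi> ` {1..i}\<close> (\<open>flag_eq_gale_perm_image\<close>).\<close>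


section \<open>The Gale order by counting\<close>

text \<open>The entries \<open>\<le> m\<close> of a sorted list form a prefix, so its length decides which entries
  belong to it.\<close>

lemma nth_le_iff_less_card:
  fixes xs :: "'a::linorder list"
  assumes "sorted xs" and "distinct xs" and k: "k < length xs"
  shows "xs ! k \<le> m \<longleftrightarrow> k < card {x \<in> set xs. x \<le> m}"
proof -
  define I where "I = {i. i < length xs \<and> xs ! i \<le> m}"
  have fin: "finite I" by (simp add: I_def)
  have "{x \<in> set xs. x \<le> m} = (!) xs ` I"
    by (auto simp: I_def in_set_conv_nth)
  moreover have "inj_on ((!) xs) I"
    using assms(2) by (auto simp: I_def inj_on_def nth_eq_iff_index_eq)
  ultimately have card: "card {x \<in> set xs. x \<le> m} = card I"
    by (simp add: card_image)
  show ?thesis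
  proof (cases "xs ! k \<le> m")
    case True
    have "{..k} \<subseteq> I"
      using True k sorted_nth_mono[OF assms(1)] by (fastforce simp: I_def)
    then have "card {..k} \<le> card I" by (rule card_mono[OF fin])
    then show ?thesis using True card by simp
  next
    case False
    have "I \<subseteq> {..<k}"
    proof
      fix i assume i: "i \<in> I"
      have "\<not> k \<le> i"
        using False i sorted_nth_mono[OF assms(1), of k i] by (auto simp: I_def)
      then show "i \<in> {..<k}" by simp
    qed
    then have "card I \<le> card {..<k}" by (rule card_mono[rotated]) simp
    then show ?thesis using False card by simp
  qed
qed

lemma gale_le_iff_card_le:
  assumes "finite A" and "finite B" and "card A = card B"
  shows "gale_le A B \<longleftrightarrow> (\<forall>m. card {x \<in> B. x \<le> m} \<le> card {x \<in> A. x \<le> m})"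
proof -
  define xs ys where "xs = sorted_list_of_set A" and "ys = sorted_list_of_set B"
  have len: "length xs = card A" "length ys = card A"
    using assms by (simp_all add: xs_def ys_def)
  have A: "xs ! k \<le> m \<longleftrightarrow> k < card {x \<in> A. x \<le> m}" if "k < card A" for k m
    using nth_le_iff_less_card[of xs k m] that assms by (simp add: xs_def)
  have B: "ys ! k \<le> m \<longleftrightarrow> k < card {x \<in> B. x \<le> m}" if "k < card A" for k m
    using nth_le_iff_less_card[of ys k m] that assms by (simp add: ys_def)
  have "gale_le A B \<longleftrightarrow> (\<forall>k < card A. xs ! k \<le> ys ! k)"
    by (simp add: gale_le_def list_all2_conv_all_nth len flip: xs_def ys_def)
  also have "\<dots> \<longleftrightarrow> (\<forall>m. card {x \<in> B. x \<le> m} \<le> card {x \<in> A. x \<le> m})"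
  proof (intro iffI allI impI)
    fix m
    assume le: "\<forall>k < card A. xs ! k \<le> ys ! k"
    show "card {x \<in> B. x \<le> m} \<le> card {x \<in> A. x \<le> m}"
    proof (rule ccontr)
      define k where "k = card {x \<in> A. x \<le> m}"
      assume "\<not> ?thesis"
      then have k: "k < card {x \<in> B. x \<le> m}" by (simp add: k_def)
      also have "\<dots> \<le> card A"
        using assms by (auto intro: card_mono)
      finally have "k < card A" .
      moreover from this have "ys ! k \<le> m" using B k by simp
      ultimately have "k < k"
        using A[of k m] le by (fastforce simp flip: k_def)
      then show False by simp
    qed
  next
    fix k
    assume le: "\<forall>m. card {x \<in> B. x \<le> m} \<le> card {x \<in> A. x \<le> m}" and k: "k < card A"
    have "k < card {x \<in> B. x \<le> ys ! k}" using B[OF k, of "ys ! k"] by simp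
    also have "\<dots> \<le> card {x \<in> A. x \<le> ys ! k}" using le by blast
    finally show "xs ! k \<le> ys ! k" using A[OF k] by simp
  qed
  finally show ?thesis .
qed


section \<open>The tableau criterion for the Bruhat order\<close>

definition corner_count :: "nat \<Rightarrow> (nat \<Rightarrow> nat) \<Rightarrow> nat \<Rightarrow> nat \<Rightarrow> nat" where
  "corner_count n u m j = card {x \<in> {1..n}. x \<le> m \<and> j \<le> u x}"

lemma corner_count_eq_sum:
  "corner_count n u m j = (\<Sum>x\<in>{1..n}. of_bool (x \<le> m \<and> j \<le> u x))"
  by (simp add: corner_count_def Int_def)

lemma corner_count_transpose:
  assumes "a \<in> {1..n}" "b \<in> {1..n}" "a < b" "u a < u b"
  shows "corner_count n (u \<circ> transpose a b) m j =
    corner_count n u m j + of_bool (a \<le> m \<and> m < b \<and> u a < j \<and> j \<le> u b)"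
proof -
  define S where "S = {1..n} - {a, b}"
  have n: "{1..n} = insert a (insert b S)" and S: "finite S" "a \<notin> S" "b \<notin> S"
    using assms by (auto simp: S_def)
  have "(\<Sum>x\<in>S. of_bool (x \<le> m \<and> j \<le> (u \<circ> transpose a b) x)) =
      (\<Sum>x\<in>S. of_bool (x \<le> m \<and> j \<le> u x) :: nat)"
    by (intro sum.cong) (auto simp: S_def transpose_def)
  then show ?thesis
    using assms(3,4) S unfolding corner_count_eq_sum n by (auto simp: of_bool_def)
qed

text \<open>The reason that domination can be improved one cover at a time.  At the first position \<open>a\<close>
  where \<open>u\<close> and \<open>v\<close> differ, \<open>u a < v a\<close>.  Exchange \<open>u a\<close> with the first later entry \<open>u b\<close> that lies
  in the interval \<open>{u a<..v a}\<close>.  Between \<open>a\<close> and \<open>b\<close> no entry of \<open>u\<close> lies in that interval, which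
  makes the exchange a cover, and also forces a strict inequality between the counts on the
  rectangle where the exchange raises them.\<close>

lemma dominated_cover_exists:
  assumes u: "u permutes {1..n}" and v: "v permutes {1..n}" and ne: "u \<noteq> v"
    and dom: "\<And>m j. corner_count n u m j \<le> corner_count n v m j"
  obtains a b where "a \<in> {1..n}" "b \<in> {1..n}" "a < b" "u a < u b"
    "bruhat_covered n u (u \<circ> transpose a b)"
    "\<And>m j. corner_count n (u \<circ> transpose a b) m j \<le> corner_count n v m j"
proof -
  define a where "a = (LEAST x. u x \<noteq> v x)"
  from ne have "\<exists>x. u x \<noteq> v x" by auto
  then have ua: "u a \<noteq> v a" unfolding a_def by (rule LeastI_ex)
  have eq: "u x = v x" if "x < a" for x
    using not_less_Least[of x "\<lambda>x. u x \<noteq> v x"] that by (auto simp: a_def)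
  have a: "a \<in> {1..n}"
    using ua u v by (metis permutes_not_in)
  have less: "u a < v a"
  proof (rule ccontr)
    assume "\<not> u a < v a"
    then have gt: "v a < u a" using ua by simp
    have "{x \<in> {1..n}. x \<le> a \<and> u a \<le> v x} \<subset> {x \<in> {1..n}. x \<le> a \<and> u a \<le> u x}"
    proof
      show "{x \<in> {1..n}. x \<le> a \<and> u a \<le> v x} \<subseteq> {x \<in> {1..n}. x \<le> a \<and> u a \<le> u x}"
        using eq gt by (auto simp: le_less)
      have "a \<in> {x \<in> {1..n}. x \<le> a \<and> u a \<le> u x}" using a by simp
      moreover have "a \<notin> {x \<in> {1..n}. x \<le> a \<and> u a \<le> v x}" using gt by simp
      ultimately show
        "{x \<in> {1..n}. x \<le> a \<and> u a \<le> v x} \<noteq> {x \<in> {1..n}. x \<le> a \<and> u a \<le> u x}"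
        by blast
    qed
    then have "corner_count n v a (u a) < corner_count n u a (u a)"
      unfolding corner_count_def by (intro psubset_card_mono) auto
    then show False using dom[of a "u a"] by simp
  qed
  define P where "P = (\<lambda>x. a < x \<and> u a < u x \<and> u x \<le> v a)"
  define b where "b = (LEAST x. P x)"
  \<comment> \<open>The value \<open>v a\<close> occurs in \<open>u\<close> after position \<open>a\<close>, since before \<open>a\<close> the two permutations agree.\<close>
  obtain c where c: "u c = v a"
    using u by (metis permutes_surj surjD)
  have "a < c"
  proof (rule ccontr)
    assume "\<not> a < c"
    then consider "c < a" | "c = a" by linarith
    then show False
    proof cases
      case 1
      then have "v c = v a" using eq c by simp
      then have "c = a" using permutes_inj[OF v] by (simp add: inj_eq)
      then show False using 1 by simp
    qed (use c ua in simp)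
  qed
  then have "P c" using c less by (simp add: P_def)
  then have Pb: "P b" unfolding b_def by (rule LeastI)
  have notP: "\<not> P x" if "x < b" for x
    using not_less_Least that by (auto simp: b_def)
  have ab: "a < b" and uab: "u a < u b" and ub: "u b \<le> v a" using Pb by (auto simp: P_def)
  have b: "b \<in> {1..n}"
  proof (rule ccontr)
    assume "b \<notin> {1..n}"
    then have "u b = b" "n < b" using u ab by (auto simp: permutes_def)
    moreover have "v a \<le> n" using v a by (metis atLeastAtMost_iff permutes_in_image)
    ultimately show False using ub by simp
  qed
  have between: "u k < u a \<or> v a < u k" if "a < k" "k < b" for k
  proof -
    have "u k \<noteq> u a" using permutes_inj[OF u] that by (auto simp: inj_eq)
    then show ?thesis using notP[of k] that by (auto simp: P_def)
  qed
  have cover: "bruhat_covered n u (u \<circ> transpose a b)"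
    unfolding bruhat_covered_def
  proof (intro conjI exI)
    show "\<forall>k. a < k \<and> k < b \<longrightarrow> u k < u a \<or> u b < u k"
      using between ub by (meson le_less_trans)
  qed (use u a b ab uab in auto)
  have strict: "corner_count n u m j < corner_count n v m j"
    if m: "a \<le> m" "m < b" and j: "u a < j" "j \<le> u b" for m j
  proof -
    \<comment> \<open>Values above \<open>v a\<close> are compared by domination, values in \<open>{j..v a}\<close> directly.\<close>
    have split: "corner_count n w m j =
        card {x \<in> {1..n}. x \<le> m \<and> j \<le> w x \<and> w x \<le> v a} + corner_count n w m (Suc (v a))"
      for w
    proof -
      have "{x \<in> {1..n}. x \<le> m \<and> j \<le> w x} =
          {x \<in> {1..n}. x \<le> m \<and> j \<le> w x \<and> w x \<le> v a} \<union>
          {x \<in> {1..n}. x \<le> m \<and> Suc (v a) \<le> w x}"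
        using j ub by auto
      then show ?thesis
        unfolding corner_count_def by (simp only:) (rule card_Un_disjoint, auto)
    qed
    have "{x \<in> {1..n}. x \<le> m \<and> j \<le> u x \<and> u x \<le> v a} \<subset>
        {x \<in> {1..n}. x \<le> m \<and> j \<le> v x \<and> v x \<le> v a}"
    proof
      have "x < a" if "x \<le> m" "j \<le> u x" "u x \<le> v a" for x
        using between[of x] that m j by (cases x a rule: linorder_cases) auto
      then have "u x = v x" if "x \<le> m" "j \<le> u x" "u x \<le> v a" for x
        using that eq by blast
      then show "{x \<in> {1..n}. x \<le> m \<and> j \<le> u x \<and> u x \<le> v a} \<subseteq>
          {x \<in> {1..n}. x \<le> m \<and> j \<le> v x \<and> v x \<le> v a}"
        by fastforce
      have "a \<in> {x \<in> {1..n}. x \<le> m \<and> j \<le> v x \<and> v x \<le> v a}"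
        using a m j ub by simp
      moreover have "a \<notin> {x \<in> {1..n}. x \<le> m \<and> j \<le> u x \<and> u x \<le> v a}"
        using j by simp
      ultimately show "{x \<in> {1..n}. x \<le> m \<and> j \<le> u x \<and> u x \<le> v a} \<noteq>
          {x \<in> {1..n}. x \<le> m \<and> j \<le> v x \<and> v x \<le> v a}"
        by blast
    qed
    then have "card {x \<in> {1..n}. x \<le> m \<and> j \<le> u x \<and> u x \<le> v a} <
        card {x \<in> {1..n}. x \<le> m \<and> j \<le> v x \<and> v x \<le> v a}"
      by (intro psubset_card_mono) auto
    then show ?thesis
      using split[of u] split[of v] dom[of m "Suc (v a)"] by linarith
  qed
  have "corner_count n (u \<circ> transpose a b) m j \<le> corner_count n v m j" for m j
    using strict[of m j] dom[of m j]
    by (auto simp: corner_count_transpose[OF a b ab uab] of_bool_def Suc_le_eq)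
  then show thesis using that a b ab uab cover by blast
qed

lemma bruhat_le_of_corner_count_le:
  assumes "u permutes {1..n}" and v: "v permutes {1..n}"
    and "\<And>m j. corner_count n u m j \<le> corner_count n v m j"
  shows "bruhat_le n u v"
proof -
  \<comment> \<open>The total over \<open>m, j \<le> n\<close> grows with each cover and is bounded by its value at \<open>v\<close>.\<close>
  define total where "total w = (\<Sum>m\<le>n. \<Sum>j\<le>n. corner_count n w m j)" for w
  have "(bruhat_covered n)\<^sup>*\<^sup>* u v"
    using assms(1,3)
  proof (induction "total v - total u" arbitrary: u rule: less_induct)
    case less
    show ?case
    proof (cases "u = v")
      case False
      obtain a b where a: "a \<in> {1..n}" and b: "b \<in> {1..n}" and ab: "a < b" and uab: "u a < u b"
        and cover: "bruhat_covered n u (u \<circ> transpose a b)"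
        and dom: "\<And>m j. corner_count n (u \<circ> transpose a b) m j \<le> corner_count n v m j"
        using dominated_cover_exists[OF less.prems(1) v False less.prems(2)] by blast
      let ?w = "u \<circ> transpose a b"
      have w: "?w permutes {1..n}"
        using less.prems(1) a b by (intro permutes_compose permutes_swap_id)
      have mono: "corner_count n u m j \<le> corner_count n ?w m j" for m j
        by (simp add: corner_count_transpose[OF a b ab uab])
      have ub: "u b \<le> n" using less.prems(1) b by (metis atLeastAtMost_iff permutes_in_image)
      have "total u < total ?w"
        unfolding total_def
      proof (rule sum_strict_mono_ex1)
        show "\<forall>m\<in>{..n}. (\<Sum>j\<le>n. corner_count n u m j) \<le> (\<Sum>j\<le>n. corner_count n ?w m j)"
          by (intro ballI sum_mono mono)
        have "(\<Sum>j\<le>n. corner_count n u a j) < (\<Sum>j\<le>n. corner_count n ?w a j)"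
        proof (rule sum_strict_mono_ex1)
          show "\<exists>j\<in>{..n}. corner_count n u a j < corner_count n ?w a j"
            using ub ab uab by (intro bexI[of _ "u b"])
              (simp_all add: corner_count_transpose[OF a b ab uab])
        qed (simp_all add: mono)
        then show "\<exists>m\<in>{..n}. (\<Sum>j\<le>n. corner_count n u m j) < (\<Sum>j\<le>n. corner_count n ?w m j)"
          using a by auto
      qed simp
      moreover have "total ?w \<le> total v"
        unfolding total_def by (intro sum_mono dom)
      ultimately have "total v - total ?w < total v - total u" by linarith
      then have "(bruhat_covered n)\<^sup>*\<^sup>* ?w v"
        using less.hyps w dom by blast
      with cover show ?thesis by (rule converse_rtranclp_into_rtranclp)
    qed simp
  qed
  then show ?thesis using assms by (simp add: bruhat_le_def)
qed

lemma corner_count_mono_bruhat_covered: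
  assumes "bruhat_covered n u v"
  shows "corner_count n u m j \<le> corner_count n v m j"
  using assms unfolding bruhat_covered_def
  by (auto simp: corner_count_transpose simp del: comp_apply)

theorem bruhat_le_iff_corner_count_le:
  assumes "u permutes {1..n}" and "v permutes {1..n}"
  shows "bruhat_le n u v \<longleftrightarrow> (\<forall>m j. corner_count n u m j \<le> corner_count n v m j)"
proof
  assume "bruhat_le n u v"
  then have "(bruhat_covered n)\<^sup>*\<^sup>* u v" by (simp add: bruhat_le_def)
  then show "\<forall>m j. corner_count n u m j \<le> corner_count n v m j"
    by induction (blast intro: order_trans corner_count_mono_bruhat_covered)+
qed (use assms bruhat_le_of_corner_count_le in blast)


section \<open>Flags and their permutations\<close>

lemma flag_subset: "flag_of_bases n B \<Longrightarrow> i \<le> n \<Longrightarrow> B i \<subseteq> {1..n}"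
  and card_flag: "flag_of_bases n B \<Longrightarrow> i \<le> n \<Longrightarrow> card (B i) = i"
  by (simp_all add: flag_of_bases_def uniform_bases_def)

lemma finite_flag: "flag_of_bases n B \<Longrightarrow> i \<le> n \<Longrightarrow> finite (B i)"
  by (rule finite_subset[OF flag_subset]) simp_all

lemma flag_eq_gale_perm_image:
  assumes flag: "flag_of_bases n B"
  shows "i \<le> n \<Longrightarrow> B i = gale_perm n B ` {1..i}"
proof (induction i)
  case 0
  then show ?case using card_flag[OF flag, of 0] finite_flag[OF flag, of 0] by simp
next
  case (Suc i)
  have sub: "B i \<subseteq> B (Suc i)" using flag Suc.prems by (simp add: flag_of_bases_def)
  have "card (B (Suc i) - B i) = 1"
    using sub Suc.prems card_flag[OF flag] finite_flag[OF flag]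
    by (simp add: card_Diff_subset)
  then obtain y where y: "B (Suc i) - B i = {y}" by (rule card_1_singletonE)
  then have "B (Suc i) - B i = {gale_perm n B (Suc i)}"
    using Suc.prems by (simp add: gale_perm_def)
  then have "B (Suc i) = insert (gale_perm n B (Suc i)) (B i)" using sub by blast
  also have "B i = gale_perm n B ` {1..i}" using Suc by simp
  also have "insert (gale_perm n B (Suc i)) \<dots> = gale_perm n B ` {1..Suc i}"
    by (simp only: atLeastAtMostSuc_conv image_insert le_add1 plus_1_eq_Suc)
  finally show ?case .
qed

lemma gale_perm_permutes:
  assumes flag: "flag_of_bases n B"
  shows "gale_perm n B permutes {1..n}"
proof (rule bij_imp_permutes)
  have "B n = {1..n}"
    using flag_subset[OF flag, of n] card_flag[OF flag, of n] by (intro card_subset_eq) simp_all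
  then have img: "gale_perm n B ` {1..n} = {1..n}"
    using flag_eq_gale_perm_image[OF flag, of n] by (metis order_refl)
  then have "inj_on (gale_perm n B) {1..n}"
    by (intro eq_card_imp_inj_on) simp_all
  with img show "bij_betw (gale_perm n B) {1..n} {1..n}"
    by (simp add: bij_betw_def)
qed (auto simp: gale_perm_def)

lemma reverse_perm_permutes:
  assumes "p permutes {1..n}"
  shows "reverse_perm n p permutes {1..n}"
proof (rule bij_imp_permutes)
  have "bij_betw (\<lambda>i. n - i + 1) {1..n} {1..n}"
    by (rule bij_betwI[where g = "\<lambda>i. n - i + 1"]) auto
  then have "bij_betw (p \<circ> (\<lambda>i. n - i + 1)) {1..n} {1..n}"
    using permutes_imp_bij[OF assms] by (rule bij_betw_trans)
  then show "bij_betw (reverse_perm n p) {1..n} {1..n}"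
    by (rule bij_betw_cong[THEN iffD1, rotated]) (simp add: reverse_perm_def)
qed (auto simp: reverse_perm_def)

lemma bruhat_perm_permutes:
  "flag_of_bases n B \<Longrightarrow> bruhat_perm n B permutes {1..n}"
  unfolding bruhat_perm_def
  by (intro permutes_inv reverse_perm_permutes gale_perm_permutes)

text \<open>\<open>\<tau> x = n + 1 - \<pi>\<^sup>-\<^sup>1 x\<close>, and \<open>\<pi>\<^sup>-\<^sup>1 x\<close> is the step at which \<open>x\<close> enters the flag.\<close>

lemma flag_member_iff_bruhat_perm_ge:
  assumes flag: "flag_of_bases n B" and x: "x \<in> {1..n}" and i: "i \<le> n"
  shows "x \<in> B i \<longleftrightarrow> n + 1 - i \<le> bruhat_perm n B x"
proof -
  let ?p = "gale_perm n B" and ?t = "bruhat_perm n B x"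
  have t: "?t \<in> {1..n}"
    using bruhat_perm_permutes[OF flag] x by (metis permutes_in_image)
  have "reverse_perm n ?p ?t = x"
    unfolding bruhat_perm_def
    using reverse_perm_permutes[OF gale_perm_permutes[OF flag]] by (metis permutes_inverses(1))
  then have "x = ?p (n - ?t + 1)" using t by (simp add: reverse_perm_def)
  then have "x \<in> B i \<longleftrightarrow> ?p (n - ?t + 1) \<in> ?p ` {1..i}"
    using flag_eq_gale_perm_image[OF flag i] by simp
  also have "\<dots> \<longleftrightarrow> n - ?t + 1 \<in> {1..i}"
    using permutes_inj[OF gale_perm_permutes[OF flag]] by (rule inj_image_mem_iff)
  also have "\<dots> \<longleftrightarrow> n + 1 - i \<le> ?t" using t i by auto
  finally show ?thesis .
qed

lemma corner_count_bruhat_perm: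
  assumes flag: "flag_of_bases n B" and i: "i \<le> n"
  shows "corner_count n (bruhat_perm n B) m (n + 1 - i) = card {x \<in> B i. x \<le> m}"
proof -
  have "{x \<in> {1..n}. x \<le> m \<and> n + 1 - i \<le> bruhat_perm n B x} = {x \<in> B i. x \<le> m}"
    using flag_member_iff_bruhat_perm_ge[OF flag _ i] flag_subset[OF flag i] by blast
  then show ?thesis by (simp add: corner_count_def)
qed

text \<open>The flag members give the thresholds \<open>j = n + 1 - i\<close> with \<open>1 \<le> j \<le> n\<close>; at \<open>j = 0\<close> the counts
  are those at \<open>j = 1\<close>, and for \<open>j > n\<close> they vanish.\<close>

lemma flag_gale_le_iff_bruhat_le:
  assumes flags: "flag_of_bases n B" "flag_of_bases n B'"
  shows "flag_gale_le n B B' \<longleftrightarrow> bruhat_le n (bruhat_perm n B') (bruhat_perm n B)"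
proof -
  let ?t = "bruhat_perm n B" and ?t' = "bruhat_perm n B'"
  have perm: "?t permutes {1..n}" "?t' permutes {1..n}"
    using flags by (blast intro: bruhat_perm_permutes)+
  have range: "w x \<in> {1..n}" if "w permutes {1..n}" "x \<in> {1..n}" for w x
    using that by (metis permutes_in_image)
  have "flag_gale_le n B B' \<longleftrightarrow>
      (\<forall>i\<in>{1..n}. \<forall>m. corner_count n ?t' m (n + 1 - i) \<le> corner_count n ?t m (n + 1 - i))"
    unfolding flag_gale_le_def
  proof (rule ball_cong[OF refl])
    fix i assume "i \<in> {1..n}"
    then have i: "i \<le> n" by simp
    show "gale_le (B i) (B' i) \<longleftrightarrow>
        (\<forall>m. corner_count n ?t' m (n + 1 - i) \<le> corner_count n ?t m (n + 1 - i))"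
      unfolding flags[THEN corner_count_bruhat_perm, OF i]
      using flags i by (intro gale_le_iff_card_le) (simp_all add: finite_flag card_flag)
  qed
  also have "\<dots> \<longleftrightarrow> (\<forall>m j. corner_count n ?t' m j \<le> corner_count n ?t m j)"
  proof (intro iffI allI ballI)
    fix m j
    assume *: "\<forall>i\<in>{1..n}. \<forall>m. corner_count n ?t' m (n + 1 - i) \<le> corner_count n ?t m (n + 1 - i)"
    have pos: "corner_count n ?t' m j \<le> corner_count n ?t m j" if "j \<in> {1..n}" for j
      using *[rule_format, of "n + 1 - j" m] that by fastforce
    have zero: "corner_count n w m 0 = corner_count n w m 1" if "w permutes {1..n}" for w
      unfolding corner_count_def using range[OF that]
      by (intro arg_cong[where f = card]) auto
    have large: "corner_count n w m j = 0" if "w permutes {1..n}" "n < j" for w j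
      unfolding corner_count_def using range[OF that(1)] that(2) by fastforce
    have "corner_count n ?t' m j \<le> corner_count n ?t m j" if "1 \<le> j" for j
      using that pos[of j] large[of _ j] perm by (cases "j \<le> n") simp_all
    from this[of j] this[of 1] show "corner_count n ?t' m j \<le> corner_count n ?t m j"
      using zero perm by (cases "j = 0") simp_all
  qed blast
  also have "\<dots> \<longleftrightarrow> bruhat_le n ?t' ?t"
    using bruhat_le_iff_corner_count_le perm by blast
  finally show ?thesis .
qed

lemma perm_gale_le_gale_perm_iff:
  assumes flags: "flag_of_bases n B" "flag_of_bases n B'"
  shows "perm_gale_le n (gale_perm n B) (gale_perm n B') \<longleftrightarrow> flag_gale_le n B B'"
proof
  assume "perm_gale_le n (gale_perm n B) (gale_perm n B')"
  then obtain C C' where C: "flag_of_bases n C" "flag_of_bases n C'"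
    "gale_perm n B = gale_perm n C" "gale_perm n B' = gale_perm n C'" "flag_gale_le n C C'"
    unfolding perm_gale_le_def by blast
  have "B i = C i \<and> B' i = C' i" if "i \<le> n" for i
    using that C flags by (simp add: flag_eq_gale_perm_image)
  then show "flag_gale_le n B B'" using C(5) by (simp add: flag_gale_le_def)
qed (use flags in \<open>auto simp: perm_gale_le_def\<close>)

theorem theorem32:
  fixes n :: nat and B B' :: "nat \<Rightarrow> nat set"
  assumes "flag_of_bases n B" and "flag_of_bases n B'"
  shows "(flag_gale_le n B B' \<longleftrightarrow> perm_gale_le n (gale_perm n B) (gale_perm n B')) \<and>
         (perm_gale_le n (gale_perm n B) (gale_perm n B') \<longleftrightarrow>
            bruhat_le n (bruhat_perm n B') (bruhat_perm n B))"
  using assms by (simp add: perm_gale_le_gale_perm_iff flag_gale_le_iff_bruhat_le)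

end
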